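(* Let $\mathcal{M}$ be a von Neumann algebra and let $\preceq$ be the star order on $\mathcal{M}$. If $\mathcal{M}$ is finite-dimensional, then the order topology $\tau_o(\mathcal{M},\preceq)$ is discrete.
   Context: A von Neumann algebra is a strongly closed C*-subalgebra of the C*-algebra $\mathscr{B}(\mathscr{H})$ of all bounded operators on a complex Hilbert space $\mathscr{H}$. The star order on $\mathcal{M}$ is the partial order defined by $x\preceq y$ if and only if $x^*x=x^*y$ and $xx^*=yx^*$. Order convergence and order topology: let $(P,\leq)$ be a poset. A net $(x_\alpha)_{\alpha\in\Gamma}$ in $P$ is order convergent to $x\in P$ in $(P,\leq)$ if there are nets $(y_\alpha)_{\alpha\in\Gamma}$ and $(z_\alpha)_{\alpha\in\Gamma}$ in $P$ (with the same index set) such that $y_\alpha\leq x_\alpha\leq z_\alpha$ for all $\alpha\in\Gamma$, $(y_\alpha)$ is increasing with supremum $x$ in $P$, and $(z_\alpha)$ is decreasing with infimum $x$ in $P$. A subset $C\subseteq P$ is order closed if no net in $C$ is order convergent to a point of $P\setminus C$. The order topology $\tau_o(P,\leq)$ is the topology on $P$ whose closed sets are exactly the order closed sets. *)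

theory Defs
  imports "HOL-Analysis.Analysis" "HOL-Algebra.Order"
begin

section \<open>Complex Hilbert spaces\<close>

text \<open>The inner product is linear in the first argument. Positive definiteness is contained in
  \<open>cinner_self\<close>, which says that the norm is the one induced by the inner product.\<close>

class complex_hilbert_space = banach +
  fixes scaleC :: "complex \<Rightarrow> 'a \<Rightarrow> 'a" (infixr \<open>*\<^sub>C\<close> 75)
    and cinner :: "'a \<Rightarrow> 'a \<Rightarrow> complex"
  assumes scaleC_add_right: "c *\<^sub>C (x + y) = c *\<^sub>C x + c *\<^sub>C y"
    and scaleC_add_left: "(c + d) *\<^sub>C x = c *\<^sub>C x + d *\<^sub>C x"
    and scaleC_scaleC: "c *\<^sub>C (d *\<^sub>C x) = (c * d) *\<^sub>C x"
    and scaleR_scaleC: "r *\<^sub>R x = complex_of_real r *\<^sub>C x"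
    and cinner_commute: "cinner x y = cnj (cinner y x)"
    and cinner_add_left: "cinner (x + y) z = cinner x z + cinner y z"
    and cinner_scaleC_left: "cinner (c *\<^sub>C x) y = c * cinner x y"
    and cinner_self: "cinner x x = complex_of_real ((norm x)\<^sup>2)"

lemma scaleC_one: "1 *\<^sub>C x = x"
  using scaleR_scaleC[of 1 x] by simp

lemma cinner_add_right: "cinner x (y + z) = cinner x y + cinner x z"
  by (metis cinner_add_left cinner_commute complex_cnj_add)

lemma cinner_scaleC_right: "cinner x (c *\<^sub>C y) = cnj c * cinner x y"
  by (metis cinner_commute cinner_scaleC_left complex_cnj_mult)

lemma cinner_scaleR_left: "cinner (r *\<^sub>R x) y = complex_of_real r * cinner x y"
  by (simp add: scaleR_scaleC cinner_scaleC_left)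

lemma cinner_scaleR_right: "cinner x (r *\<^sub>R y) = complex_of_real r * cinner x y"
  by (simp add: scaleR_scaleC cinner_scaleC_right)

lemma cinner_minus_left: "cinner (- x) y = - cinner x y"
  using cinner_scaleR_left[of "- 1" x y] by simp

lemma cinner_minus_right: "cinner x (- y) = - cinner x y"
  using cinner_scaleR_right[of x "- 1" y] by simp

lemma cinner_diff_left: "cinner (x - y) z = cinner x z - cinner y z"
  using cinner_add_left[of x "- y" z] by (simp add: cinner_minus_left)

lemma cinner_diff_right: "cinner x (y - z) = cinner x y - cinner x z"
  using cinner_add_right[of x y "- z"] by (simp add: cinner_minus_right)

lemma cinner_self_eq_0: "cinner x x = 0 \<longleftrightarrow> x = 0"
  by (simp add: cinner_self)

lemma cinner_eqI:
  assumes "\<And>z. cinner z x = cinner z y"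
  shows "x = y"
proof -
  have "cinner (x - y) (x - y) = 0"
    using assms by (simp add: cinner_diff_right)
  then show ?thesis
    by (simp add: cinner_self_eq_0)
qed

lemma norm_scaleC: "norm (c *\<^sub>C x) = cmod c * norm x"
proof -
  have "complex_of_real ((norm (c *\<^sub>C x))\<^sup>2) = cinner (c *\<^sub>C x) (c *\<^sub>C x)"
    by (simp add: cinner_self)
  also have "\<dots> = (c * cnj c) * cinner x x"
    by (simp add: cinner_scaleC_left cinner_scaleC_right)
  also have "\<dots> = complex_of_real ((cmod c * norm x)\<^sup>2)"
    by (simp add: cinner_self complex_norm_square[symmetric] power_mult_distrib)
  finally have "(norm (c *\<^sub>C x))\<^sup>2 = (cmod c * norm x)\<^sup>2"
    using of_real_eq_iff by blast
  then show ?thesis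
    by (simp add: power2_eq_iff_nonneg)
qed

lemma norm_add_sq:
  fixes x y :: "'h::complex_hilbert_space"
  shows "(norm (x + y))\<^sup>2 = (norm x)\<^sup>2 + (norm y)\<^sup>2 + 2 * Re (cinner y x)"
proof -
  have "complex_of_real ((norm (x + y))\<^sup>2) = cinner x x + cinner y y + (cinner y x + cinner x y)"
    unfolding cinner_self[symmetric] by (simp add: cinner_add_left cinner_add_right)
  also have "cinner y x + cinner x y = complex_of_real (2 * Re (cinner y x))"
    by (subst cinner_commute[of x y]) (simp add: complex_add_cnj)
  finally have "complex_of_real ((norm (x + y))\<^sup>2)
      = complex_of_real ((norm x)\<^sup>2 + (norm y)\<^sup>2 + 2 * Re (cinner y x))"
    by (simp add: cinner_self)
  then show ?thesis
    using of_real_eq_iff by blast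
qed

lemma parallelogram:
  fixes x y :: "'h::complex_hilbert_space"
  shows "(norm (x + y))\<^sup>2 + (norm (x - y))\<^sup>2 = 2 * (norm x)\<^sup>2 + 2 * (norm y)\<^sup>2"
  using norm_add_sq[of x y] norm_add_sq[of x "- y"] by (simp add: cinner_minus_left)

lemma Cauchy_Schwarz_Re: "Re (cinner x y) \<le> norm x * norm y"
proof -
  have "(norm (y + x))\<^sup>2 \<le> (norm y + norm x)\<^sup>2"
    by (intro power_mono norm_triangle_ineq) simp
  then show ?thesis
    using norm_add_sq[of y x] by (simp add: power2_sum mult.commute)
qed

lemma Cauchy_Schwarz: "cmod (cinner x y) \<le> norm x * norm y"
proof (cases "cinner x y = 0")
  case False
  define c where "c = cnj (cinner x y) / complex_of_real (cmod (cinner x y))"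
  have c: "cmod c = 1" "c * cinner x y = complex_of_real (cmod (cinner x y))"
    using False unfolding c_def
    by (simp_all add: norm_divide complex_norm_square[symmetric] power2_eq_square
        mult.commute[of "cnj _"])
  have "cmod (cinner x y) = Re (cinner (c *\<^sub>C x) y)"
    using c by (simp add: cinner_scaleC_left)
  also have "\<dots> \<le> norm x * norm y"
    using Cauchy_Schwarz_Re[of "c *\<^sub>C x" y] c by (simp add: norm_scaleC)
  finally show ?thesis .
qed simp

lemma riesz_representation:
  fixes f :: "'h::complex_hilbert_space \<Rightarrow> complex"
  assumes lin: "bounded_linear f" and C: "\<And>c x. f (c *\<^sub>C x) = c * f x"
  shows "\<exists>a. \<forall>x. f x = cinner x a"
proof -
  interpret bounded_linear f by (rule lin)
  obtain K where K: "\<And>x. cmod (f x) \<le> norm x * K"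
    using bounded by blast
  define g where "g x = (norm x)\<^sup>2 - 2 * Re (f x)" for x
  have lower: "g x \<ge> - (K\<^sup>2)" for x
  proof -
    have "Re (f x) \<le> norm x * K"
      using K[of x] complex_Re_le_cmod[of "f x"] by linarith
    moreover have "0 \<le> (norm x - K)\<^sup>2" by simp
    ultimately show ?thesis
      unfolding g_def by (simp add: power2_diff)
  qed
  have bdd: "bdd_below (range g)"
    using lower by (intro bdd_belowI[of _ "- (K\<^sup>2)"]) auto
  define m where "m = Inf (range g)"
  have m: "m \<le> g x" for x
    unfolding m_def by (intro cInf_lower bdd) simp
  have par: "(norm (x - y))\<^sup>2 \<le> 2 * (g x - m) + 2 * (g y - m)" for x y
  proof -
    have "4 * g ((1/2) *\<^sub>R (x + y)) = (norm (x + y))\<^sup>2 - 4 * Re (f x) - 4 * Re (f y)"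
      unfolding g_def norm_scaleR scaleR add by (simp add: power_divide field_simps)
    then have "2 * g x + 2 * g y = 4 * g ((1/2) *\<^sub>R (x + y)) + (norm (x - y))\<^sup>2"
      using parallelogram[of x y] by (simp add: g_def)
    then show ?thesis
      using m[of "(1/2) *\<^sub>R (x + y)"] by argo
  qed
  have "\<exists>x. g x < m + inverse (real (Suc n))" for n
  proof -
    have "Inf (range g) < m + inverse (real (Suc n))"
      unfolding m_def by (simp del: of_nat_Suc)
    then show ?thesis
      using cInf_lessD[of "range g"] by auto
  qed
  then obtain u where u: "\<And>n. g (u n) < m + inverse (real (Suc n))"
    by metis
  have "Cauchy u"
  proof (rule metric_CauchyI)
    fix e :: real assume e: "e > 0"
    obtain N where N: "inverse (real (Suc N)) < e\<^sup>2 / 4"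
      using reals_Archimedean[of "e\<^sup>2 / 4"] e by auto
    have small: "g (u n) - m < e\<^sup>2 / 4" if "n \<ge> N" for n
    proof -
      have "inverse (real (Suc n)) \<le> inverse (real (Suc N))"
        using that by (simp add: field_simps)
      then show ?thesis using u[of n] N by linarith
    qed
    have "dist (u i) (u j) < e" if "i \<ge> N" "j \<ge> N" for i j
    proof -
      have "(norm (u i - u j))\<^sup>2 < e\<^sup>2"
        using par[of "u i" "u j"] small[OF that(1)] small[OF that(2)] by argo
      then show ?thesis
        using e by (simp add: dist_norm power_less_imp_less_base)
    qed
    then show "\<exists>N. \<forall>i\<ge>N. \<forall>j\<ge>N. dist (u i) (u j) < e" by blast
  qed
  then obtain a where a: "u \<longlonglongrightarrow> a"
    using Cauchy_convergent convergent_def by blast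
  have "(\<lambda>n. g (u n)) \<longlonglongrightarrow> g a"
    unfolding g_def by (intro tendsto_intros tendsto[OF a] a)
  moreover have "(\<lambda>n. m + inverse (real (Suc n))) \<longlonglongrightarrow> m + 0"
    by (intro tendsto_intros LIMSEQ_inverse_real_of_nat)
  ultimately have "g a \<le> m"
    using u by (intro LIMSEQ_le[of "\<lambda>n. g (u n)" "g a" _ m]) (auto intro: less_imp_le simp del: of_nat_Suc)
  then have min: "g a \<le> g x" for x
    using m[of x] by linarith
  have Re_eq: "Re (f y) = Re (cinner y a)" for y
  proof -
    define A where "A = (norm y)\<^sup>2"
    define B where "B = Re (cinner y a) - Re (f y)"
    have quad: "0 \<le> t\<^sup>2 * A + 2 * t * B" for t
    proof -
      have "g (a + t *\<^sub>R y) = g a + (t\<^sup>2 * A + 2 * t * B)"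
        unfolding g_def A_def B_def
        by (simp add: norm_add_sq add scaleR cinner_scaleR_left power_mult_distrib algebra_simps)
      then show ?thesis using min[of "a + t *\<^sub>R y"] by linarith
    qed
    have A: "A \<ge> 0" unfolding A_def by simp
    have "0 \<le> (- B / (A + 1))\<^sup>2 * A + 2 * (- B / (A + 1)) * B" by (rule quad)
    also have "\<dots> = - (B\<^sup>2 * (A + 2)) / (A + 1)\<^sup>2"
      using A by (simp add: divide_simps power2_eq_square) (simp add: algebra_simps)
    finally have "B\<^sup>2 * (A + 2) \<le> 0"
      using A by (simp add: divide_simps split: if_splits)
    then have "B = 0"
      using A by (simp add: mult_le_0_iff)
    then show ?thesis unfolding B_def by simp
  qed
  have "f x = cinner x a" for x
  proof (rule complex_eqI)
    show "Re (f x) = Re (cinner x a)" by (rule Re_eq)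
    have "Re (\<i> * f x) = Re (\<i> * cinner x a)"
      using Re_eq[of "\<i> *\<^sub>C x"] by (simp only: C cinner_scaleC_left)
    then show "Im (f x) = Im (cinner x a)" by simp
  qed
  then show ?thesis by blast
qed


section \<open>Bounded operators\<close>

text \<open>Elements of \<^typ>\<open>'h \<Rightarrow>\<^sub>L 'h\<close> are the bounded real-linear maps; \<open>bounded_ops\<close> is the algebra
  of all bounded complex-linear operators among them.\<close>

definition bounded_ops :: "('h::complex_hilbert_space \<Rightarrow>\<^sub>L 'h) set" where
  "bounded_ops = {T. \<forall>c x. blinfun_apply T (c *\<^sub>C x) = c *\<^sub>C blinfun_apply T x}"

lift_definition scaleC_op ::
    "complex \<Rightarrow> ('h::complex_hilbert_space \<Rightarrow>\<^sub>L 'h) \<Rightarrow> 'h \<Rightarrow>\<^sub>L 'h" is "\<lambda>c f x. c *\<^sub>C f x"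
proof -
  fix c and f :: "'h \<Rightarrow> 'h"
  assume "bounded_linear f"
  then interpret bounded_linear f .
  obtain K where K: "\<And>x. norm (f x) \<le> norm x * K"
    using bounded by blast
  show "bounded_linear (\<lambda>x. c *\<^sub>C f x)"
  proof (rule bounded_linear_intro[where K = "cmod c * K"])
    fix r x
    show "c *\<^sub>C f (r *\<^sub>R x) = r *\<^sub>R (c *\<^sub>C f x)"
      unfolding scaleR by (simp add: scaleR_scaleC scaleC_scaleC mult.commute)
    show "norm (c *\<^sub>C f x) \<le> norm x * (cmod c * K)"
      using mult_left_mono[OF K[of x], of "cmod c"] by (simp add: norm_scaleC algebra_simps)
  qed (simp add: add scaleC_add_right)
qed

interpretation cop: vector_space "scaleC_op :: complex \<Rightarrow> ('h::complex_hilbert_space \<Rightarrow>\<^sub>L 'h) \<Rightarrow> _"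
  by unfold_locales
    (transfer; simp add: fun_eq_iff scaleC_add_right scaleC_add_left scaleC_scaleC scaleC_one)+

definition adj :: "('h::complex_hilbert_space \<Rightarrow>\<^sub>L 'h) \<Rightarrow> 'h \<Rightarrow>\<^sub>L 'h" where
  "adj T = (THE S. \<forall>x y. cinner (blinfun_apply T x) y = cinner x (blinfun_apply S y))"

lemma adj_unique:
  assumes "\<And>x y. cinner (blinfun_apply T x) y = cinner x (blinfun_apply S y)"
    and "\<And>x y. cinner (blinfun_apply T x) y = cinner x (blinfun_apply S' y)"
  shows "S = S'"
proof (intro blinfun_eqI cinner_eqI)
  show "cinner z (blinfun_apply S y) = cinner z (blinfun_apply S' y)" for y z
    using assms[of z y] by simp
qed

lemma cinner_adj:
  assumes T: "T \<in> bounded_ops"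
  shows "cinner (blinfun_apply T x) y = cinner x (blinfun_apply (adj T) y)"
proof -
  have "\<exists>a. \<forall>x. cinner (blinfun_apply T x) y = cinner x a" for y
  proof (rule riesz_representation)
    show "bounded_linear (\<lambda>x. cinner (blinfun_apply T x) y)"
    proof (rule bounded_linear_intro[where K = "norm T * norm y"])
      fix x
      have "cmod (cinner (blinfun_apply T x) y) \<le> norm (blinfun_apply T x) * norm y"
        by (rule Cauchy_Schwarz)
      also have "\<dots> \<le> (norm T * norm x) * norm y"
        by (intro mult_right_mono norm_blinfun) simp
      finally show "cmod (cinner (blinfun_apply T x) y) \<le> norm x * (norm T * norm y)"
        by (simp add: algebra_simps)
    qed (simp_all add: blinfun.add_right blinfun.scaleR_right cinner_add_left cinner_scaleR_left
        scaleR_conv_of_real)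
    show "cinner (blinfun_apply T (c *\<^sub>C x)) y = c * cinner (blinfun_apply T x) y" for c x
      using T by (simp add: bounded_ops_def cinner_scaleC_left)
  qed
  then obtain s where s: "\<And>x y. cinner (blinfun_apply T x) y = cinner x (s y)"
    by metis
  have "bounded_linear s"
  proof (rule bounded_linear_intro[where K = "norm T"])
    show "s (x + y) = s x + s y" for x y
      by (rule cinner_eqI) (simp add: s[symmetric] cinner_add_right)
    show "s (r *\<^sub>R x) = r *\<^sub>R s x" for r x
      by (rule cinner_eqI) (simp add: s[symmetric] cinner_scaleR_right)
    fix y
    have "complex_of_real ((norm (s y))\<^sup>2) = cinner (blinfun_apply T (s y)) y"
      by (simp add: s cinner_self)
    then have "(norm (s y))\<^sup>2 = cmod (cinner (blinfun_apply T (s y)) y)"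
      by (metis abs_power2 norm_of_real real_norm_def)
    also have "\<dots> \<le> norm (blinfun_apply T (s y)) * norm y"
      by (rule Cauchy_Schwarz)
    also have "\<dots> \<le> (norm T * norm (s y)) * norm y"
      by (intro mult_right_mono norm_blinfun) simp
    finally have "norm (s y) * norm (s y) \<le> norm (s y) * (norm y * norm T)"
      by (simp add: power2_eq_square algebra_simps)
    then show "norm (s y) \<le> norm y * norm T"
      by (cases "s y = 0") simp_all
  qed
  then obtain S where S: "\<forall>x y. cinner (blinfun_apply T x) y = cinner x (blinfun_apply S y)"
    using s by (metis bounded_linear_Blinfun_apply)
  have "\<forall>x y. cinner (blinfun_apply T x) y = cinner x (blinfun_apply (adj T) y)"
    unfolding adj_def
  proof (rule theI)
    show "S' = S" if "\<forall>x y. cinner (blinfun_apply T x) y = cinner x (blinfun_apply S' y)" for S'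
      using adj_unique[of T S' S] S that by blast
  qed (rule S)
  then show ?thesis by blast
qed

definition cstar_subalgebra :: "('h::complex_hilbert_space \<Rightarrow>\<^sub>L 'h) set \<Rightarrow> bool" where
  "cstar_subalgebra M \<longleftrightarrow>
     M \<subseteq> bounded_ops \<and> cop.subspace M \<and>
     (\<forall>S\<in>M. \<forall>T\<in>M. S o\<^sub>L T \<in> M) \<and> (\<forall>T\<in>M. adj T \<in> M) \<and> closed M"

text \<open>The identity operator is not required to belong to the algebra.\<close>

definition von_neumann_algebra :: "('h::complex_hilbert_space \<Rightarrow>\<^sub>L 'h) set \<Rightarrow> bool" where
  "von_neumann_algebra M \<longleftrightarrow>
     cstar_subalgebra M \<and> closedin (subtopology strong_operator_topology bounded_ops) M"

definition complex_finite_dimensional :: "('h::complex_hilbert_space \<Rightarrow>\<^sub>L 'h) set \<Rightarrow> bool" where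
  "complex_finite_dimensional M \<longleftrightarrow> (\<exists>B. finite B \<and> B \<subseteq> M \<and> M = cop.span B)"

definition star_le :: "('h::complex_hilbert_space \<Rightarrow>\<^sub>L 'h) \<Rightarrow> ('h \<Rightarrow>\<^sub>L 'h) \<Rightarrow> bool" where
  "star_le x y \<longleftrightarrow> adj x o\<^sub>L x = adj x o\<^sub>L y \<and> x o\<^sub>L adj x = y o\<^sub>L adj x"

definition star_poset :: "('h::complex_hilbert_space \<Rightarrow>\<^sub>L 'h) set \<Rightarrow> ('h \<Rightarrow>\<^sub>L 'h) gorder" where
  "star_poset M = \<lparr>carrier = M, eq = (=), le = star_le\<rparr>"


section \<open>Order convergence and the order topology of a poset\<close>

definition directed_set :: "'i set \<Rightarrow> ('i \<Rightarrow> 'i \<Rightarrow> bool) \<Rightarrow> bool" where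
  "directed_set I r \<longleftrightarrow> I \<noteq> {} \<and> (\<forall>i\<in>I. r i i) \<and>
     (\<forall>i\<in>I. \<forall>j\<in>I. \<forall>k\<in>I. r i j \<longrightarrow> r j k \<longrightarrow> r i k) \<and>
     (\<forall>i\<in>I. \<forall>j\<in>I. \<exists>k\<in>I. r i k \<and> r j k)"

definition order_convergent ::
    "('a, 'm) gorder_scheme \<Rightarrow> 'i set \<Rightarrow> ('i \<Rightarrow> 'i \<Rightarrow> bool) \<Rightarrow> ('i \<Rightarrow> 'a) \<Rightarrow> 'a \<Rightarrow> bool" where
  "order_convergent P I r x a \<longleftrightarrow> x ` I \<subseteq> carrier P \<and> a \<in> carrier P \<and>
     (\<exists>y z. y ` I \<subseteq> carrier P \<and> z ` I \<subseteq> carrier P \<and>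
        (\<forall>i\<in>I. y i \<sqsubseteq>\<^bsub>P\<^esub> x i \<and> x i \<sqsubseteq>\<^bsub>P\<^esub> z i) \<and>
        (\<forall>i\<in>I. \<forall>j\<in>I. r i j \<longrightarrow> y i \<sqsubseteq>\<^bsub>P\<^esub> y j) \<and> is_lub P a (y ` I) \<and>
        (\<forall>i\<in>I. \<forall>j\<in>I. r i j \<longrightarrow> z j \<sqsubseteq>\<^bsub>P\<^esub> z i) \<and> is_glb P a (z ` I))"

lemma order_convergentI:
  assumes "x ` I \<subseteq> carrier P" and "a \<in> carrier P" and "y ` I \<subseteq> carrier P" and "z ` I \<subseteq> carrier P"
    and "\<And>i. i \<in> I \<Longrightarrow> y i \<sqsubseteq>\<^bsub>P\<^esub> x i" and "\<And>i. i \<in> I \<Longrightarrow> x i \<sqsubseteq>\<^bsub>P\<^esub> z i"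
    and "\<And>i j. i \<in> I \<Longrightarrow> j \<in> I \<Longrightarrow> r i j \<Longrightarrow> y i \<sqsubseteq>\<^bsub>P\<^esub> y j" and "is_lub P a (y ` I)"
    and "\<And>i j. i \<in> I \<Longrightarrow> j \<in> I \<Longrightarrow> r i j \<Longrightarrow> z j \<sqsubseteq>\<^bsub>P\<^esub> z i" and "is_glb P a (z ` I)"
  shows "order_convergent P I r x a"
  unfolding order_convergent_def by (rule conjI, fact, rule conjI, fact, rule exI[of _ y], rule exI[of _ z])
    (simp add: assms)

text \<open>A definition cannot quantify over the types of index sets. Here the index sets are subsets of
  \<^typ>\<open>'a \<times> 'a\<close>; this is no restriction, because a net may be reindexed by the pairs formed by its
  lower and upper bounds. The lemma \<open>order_closedD\<close> below gives closedness under nets with an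
  arbitrary index type.\<close>

definition order_closed :: "('a, 'm) gorder_scheme \<Rightarrow> 'a set \<Rightarrow> bool" where
  "order_closed P C \<longleftrightarrow> C \<subseteq> carrier P \<and>
     \<not> (\<exists>(I :: ('a \<times> 'a) set) r x a.
          directed_set I r \<and> x ` I \<subseteq> C \<and> a \<in> carrier P - C \<and> order_convergent P I r x a)"

definition order_topology_of :: "('a, 'm) gorder_scheme \<Rightarrow> 'a topology" where
  "order_topology_of P = topology (\<lambda>U. U \<subseteq> carrier P \<and> order_closed P (carrier P - U))"

context partial_order
begin

lemma order_closedD:
  fixes I :: "'i set"
  assumes C: "order_closed L C" and I: "directed_set I r" and x: "x ` I \<subseteq> C"
    and conv: "order_convergent L I r x a"
  shows "a \<in> C"
proof -
  obtain y z where yz: "y ` I \<subseteq> carrier L" "z ` I \<subseteq> carrier L"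
      "\<forall>i\<in>I. y i \<sqsubseteq> x i \<and> x i \<sqsubseteq> z i"
      "\<forall>i\<in>I. \<forall>j\<in>I. r i j \<longrightarrow> y i \<sqsubseteq> y j" "is_lub L a (y ` I)"
      "\<forall>i\<in>I. \<forall>j\<in>I. r i j \<longrightarrow> z j \<sqsubseteq> z i" "is_glb L a (z ` I)"
    and a: "a \<in> carrier L" and xL: "x ` I \<subseteq> carrier L"
    using conv unfolding order_convergent_def by (elim conjE exE) (rule that)
  define J where "J = (\<lambda>i. (y i, z i)) ` I"
  define s where "s p q \<longleftrightarrow> fst p \<sqsubseteq> fst q \<and> snd q \<sqsubseteq> snd p" for p q
  define k where "k = inv_into I (\<lambda>i. (y i, z i))"
  have k: "k p \<in> I" "y (k p) = fst p" "z (k p) = snd p" if "p \<in> J" for p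
    using inv_into_into[of p "\<lambda>i. (y i, z i)" I] f_inv_into_f[of p "\<lambda>i. (y i, z i)" I] that
    unfolding J_def k_def by auto
  have JL: "fst p \<in> carrier L" "snd p \<in> carrier L" if "p \<in> J" for p
    using that yz(1,2) unfolding J_def by auto
  have yzL: "y ` I \<subseteq> carrier L" "z ` I \<subseteq> carrier L"
    by fact+
  have img: "fst ` J = y ` I" "snd ` J = z ` I"
    unfolding J_def by (simp_all add: image_image)
  have "directed_set J s"
    unfolding directed_set_def
  proof (intro conjI ballI impI)
    show "J \<noteq> {}"
      using I unfolding J_def directed_set_def by simp
  next
    fix p assume "p \<in> J"
    then show "s p p" unfolding s_def using JL by simp
  next
    fix p q t assume "p \<in> J" "q \<in> J" "t \<in> J" "s p q" "s q t"
    then show "s p t" unfolding s_def using JL by (meson le_trans)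
  next
    fix p q assume "p \<in> J" "q \<in> J"
    then obtain i j where ij: "i \<in> I" "p = (y i, z i)" "j \<in> I" "q = (y j, z j)"
      unfolding J_def by blast
    then obtain l where "l \<in> I" "r i l" "r j l"
      using I unfolding directed_set_def by meson
    then show "\<exists>t\<in>J. s p t \<and> s q t"
      using ij yz(4,6) unfolding J_def s_def by (intro bexI[of _ "(y l, z l)"]) auto
  qed
  moreover have "(\<lambda>p. x (k p)) ` J \<subseteq> C"
    using k(1) x by blast
  moreover have "order_convergent L J s (\<lambda>p. x (k p)) a"
  proof (rule order_convergentI[where y = fst and z = snd])
    show "(\<lambda>p. x (k p)) ` J \<subseteq> carrier L" using k(1) xL by blast
    show "fst p \<sqsubseteq> x (k p)" "x (k p) \<sqsubseteq> snd p" if "p \<in> J" for p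
      using k[OF that] yz(3) by metis+
  qed (use a JL yz(5,7) in \<open>simp_all add: yzL img s_def\<close>)
  ultimately show ?thesis
    using C a unfolding order_closed_def by blast
qed

lemma order_convergent_cofinal:
  assumes conv: "order_convergent L I r x a" and J: "J \<subseteq> I"
    and cof: "\<And>i. i \<in> I \<Longrightarrow> \<exists>j\<in>J. r i j"
  shows "order_convergent L J r x a"
proof -
  obtain y z where yz: "y ` I \<subseteq> carrier L" "z ` I \<subseteq> carrier L"
      "\<forall>i\<in>I. y i \<sqsubseteq> x i \<and> x i \<sqsubseteq> z i"
      "\<forall>i\<in>I. \<forall>j\<in>I. r i j \<longrightarrow> y i \<sqsubseteq> y j" "is_lub L a (y ` I)"
      "\<forall>i\<in>I. \<forall>j\<in>I. r i j \<longrightarrow> z j \<sqsubseteq> z i" "is_glb L a (z ` I)"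
    and a: "a \<in> carrier L" and xL: "x ` I \<subseteq> carrier L"
    using conv unfolding order_convergent_def by (elim conjE exE) (rule that)
  have carr: "y i \<in> carrier L" "z i \<in> carrier L" if "i \<in> I" for i
    using yz(1,2) that by auto
  have Up: "u \<in> Upper L (y ` K) \<longleftrightarrow> u \<in> carrier L \<and> (\<forall>i\<in>K. y i \<sqsubseteq> u)" if "K \<subseteq> I" for K u
    using carr(1) that unfolding Upper_def by (auto simp: subset_iff)
  have Lo: "u \<in> Lower L (z ` K) \<longleftrightarrow> u \<in> carrier L \<and> (\<forall>i\<in>K. u \<sqsubseteq> z i)" if "K \<subseteq> I" for K u
    using carr(2) that unfolding Lower_def by (auto simp: subset_iff)
  have JI: "i \<in> I" if "i \<in> J" for i
    using J that by blast
  have "y i \<sqsubseteq> u" if i: "i \<in> I" and u: "u \<in> carrier L" "\<forall>j\<in>J. y j \<sqsubseteq> u" for i u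
  proof -
    obtain j where j: "j \<in> J" "r i j" using cof[OF i] by blast
    have "y i \<sqsubseteq> y j" using yz(4) i JI[OF j(1)] j(2) by blast
    moreover have "y j \<sqsubseteq> u" using u(2) j(1) by blast
    ultimately show ?thesis
      by (rule le_trans) (use carr i JI[OF j(1)] u(1) in simp_all)
  qed
  then have "Upper L (y ` J) = Upper L (y ` I)"
    unfolding set_eq_iff Up[OF J] Up[OF subset_refl] using JI by blast
  moreover have "u \<sqsubseteq> z i" if i: "i \<in> I" and u: "u \<in> carrier L" "\<forall>j\<in>J. u \<sqsubseteq> z j" for i u
  proof -
    obtain j where j: "j \<in> J" "r i j" using cof[OF i] by blast
    have "u \<sqsubseteq> z j" using u(2) j(1) by blast
    moreover have "z j \<sqsubseteq> z i" using yz(6) i JI[OF j(1)] j(2) by blast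
    ultimately show ?thesis
      by (rule le_trans) (use carr i JI[OF j(1)] u(1) in simp_all)
  qed
  then have "Lower L (z ` J) = Lower L (z ` I)"
    unfolding set_eq_iff Lo[OF J] Lo[OF subset_refl] using JI by blast
  ultimately show ?thesis
    using yz(3-7) a xL carr JI
    by (intro order_convergentI[where y = y and z = z]) (simp_all add: image_subset_iff)
qed

lemma order_closed_Un:
  assumes C: "order_closed L C" and D: "order_closed L D"
  shows "order_closed L (C \<union> D)"
  unfolding order_closed_def
proof (intro conjI notI)
  show "C \<union> D \<subseteq> carrier L"
    using C D unfolding order_closed_def by blast
next
  assume "\<exists>(I :: ('a \<times> 'a) set) r x a. directed_set I r \<and> x ` I \<subseteq> C \<union> D \<and>
    a \<in> carrier L - (C \<union> D) \<and> order_convergent L I r x a"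
  then obtain I :: "('a \<times> 'a) set" and r x a where I: "directed_set I r"
    and x: "x ` I \<subseteq> C \<union> D" and a: "a \<notin> C" "a \<notin> D" and conv: "order_convergent L I r x a"
    by blast
  have dir: "\<exists>k\<in>I. r i k \<and> r j k" if "i \<in> I" "j \<in> I" for i j
    using I that unfolding directed_set_def by blast
  have refl: "r i i" if "i \<in> I" for i
    using I that unfolding directed_set_def by blast
  have tr: "r i k" if "i \<in> I" "j \<in> I" "k \<in> I" "r i j" "r j k" for i j k
    using I that unfolding directed_set_def by blast
  have cofinal: "a \<in> E" if E: "order_closed L E" and cof: "\<forall>i\<in>I. \<exists>j\<in>I. x j \<in> E \<and> r i j" for E
  proof (rule order_closedD[OF E])
    let ?J = "{j \<in> I. x j \<in> E}"
    have cof': "\<exists>j\<in>?J. r i j" if "i \<in> I" for i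
      using cof that by blast
    show "order_convergent L ?J r x a"
      by (rule order_convergent_cofinal[OF conv _ cof']) simp_all
    obtain i where "i \<in> I"
      using I unfolding directed_set_def by blast
    then have ne: "?J \<noteq> {}"
      using cof by blast
    have "\<exists>k\<in>?J. r i k \<and> r j k" if ij: "i \<in> I" "j \<in> I" for i j
    proof -
      obtain k where k: "k \<in> I" "r i k" "r j k"
        using dir[OF ij] by blast
      obtain l where l: "l \<in> ?J" "r k l"
        using cof'[OF k(1)] by blast
      then show ?thesis
        using tr[of i k l] tr[of j k l] ij k by blast
    qed
    then have dir': "\<forall>i\<in>?J. \<forall>j\<in>?J. \<exists>k\<in>?J. r i k \<and> r j k"
      by simp
    have tr': "\<forall>i\<in>?J. \<forall>j\<in>?J. \<forall>k\<in>?J. r i j \<longrightarrow> r j k \<longrightarrow> r i k"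
      using tr by blast
    have "\<forall>i\<in>?J. r i i"
      using refl by simp
    with ne tr' dir' show "directed_set ?J r"
      unfolding directed_set_def by (intro conjI)
  qed auto
  have "\<not> (\<forall>i\<in>I. \<exists>j\<in>I. x j \<in> C \<and> r i j)"
    using cofinal[OF C] a(1) by (rule contrapos_nn[rotated])
  then obtain i where i: "i \<in> I" "\<And>l. l \<in> I \<Longrightarrow> r i l \<Longrightarrow> x l \<notin> C"
    by blast
  have "\<not> (\<forall>i\<in>I. \<exists>j\<in>I. x j \<in> D \<and> r i j)"
    using cofinal[OF D] a(2) by (rule contrapos_nn[rotated])
  then obtain j where j: "j \<in> I" "\<And>l. l \<in> I \<Longrightarrow> r j l \<Longrightarrow> x l \<notin> D"
    by blast
  obtain l where l: "l \<in> I" "r i l" "r j l"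
    using dir[OF i(1) j(1)] by blast
  then show False using i(2)[OF l(1,2)] j(2)[OF l(1,3)] x by blast
qed

lemma istopology_order: "istopology (\<lambda>U. U \<subseteq> carrier L \<and> order_closed L (carrier L - U))"
  unfolding istopology_def
proof (intro conjI allI impI)
  fix S T
  assume "S \<subseteq> carrier L \<and> order_closed L (carrier L - S)"
    and "T \<subseteq> carrier L \<and> order_closed L (carrier L - T)"
  then show "S \<inter> T \<subseteq> carrier L" and "order_closed L (carrier L - S \<inter> T)"
    using order_closed_Un[of "carrier L - S" "carrier L - T"] by (auto simp: Diff_Int)
next
  fix \<K> assume K: "\<forall>K\<in>\<K>. K \<subseteq> carrier L \<and> order_closed L (carrier L - K)"
  then show "\<Union>\<K> \<subseteq> carrier L" by blast
  show "order_closed L (carrier L - \<Union>\<K>)"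
    unfolding order_closed_def
  proof (intro conjI notI)
    assume "\<exists>(I :: ('a \<times> 'a) set) r x a. directed_set I r \<and> x ` I \<subseteq> carrier L - \<Union>\<K> \<and>
      a \<in> carrier L - (carrier L - \<Union>\<K>) \<and> order_convergent L I r x a"
    then obtain I :: "('a \<times> 'a) set" and r x a where I: "directed_set I r"
      and x: "x ` I \<subseteq> carrier L - \<Union>\<K>" and a: "a \<in> \<Union>\<K>" and conv: "order_convergent L I r x a"
      by blast
    then obtain K where K': "K \<in> \<K>" "a \<in> K" by blast
    then have "order_closed L (carrier L - K)" "x ` I \<subseteq> carrier L - K"
      using K x by blast+
    then show False
      using order_closedD[OF _ I _ conv] K' by blast
  qed blast
qed

lemma order_closed_empty: "order_closed L {}"
  unfolding order_closed_def directed_set_def by auto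

lemma openin_order_topology_of:
  "openin (order_topology_of L) U \<longleftrightarrow> U \<subseteq> carrier L \<and> order_closed L (carrier L - U)"
  by (simp add: order_topology_of_def istopology_order)

lemma topspace_order_topology_of: "topspace (order_topology_of L) = carrier L"
  unfolding topspace_def openin_order_topology_of using order_closed_empty by auto

lemma closedin_order_topology_of: "closedin (order_topology_of L) C \<longleftrightarrow> order_closed L C"
proof (cases "C \<subseteq> carrier L")
  case True
  then show ?thesis
    by (simp add: closedin_def topspace_order_topology_of openin_order_topology_of double_diff)
next
  case False
  then show ?thesis
    by (simp add: closedin_def topspace_order_topology_of order_closed_def)
qed

end


section \<open>The star order is a partial order\<close>

lemma adj_in_bounded_ops:
  assumes "T \<in> bounded_ops"
  shows "adj T \<in> bounded_ops"
  unfolding bounded_ops_def mem_Collect_eq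
  by (intro allI cinner_eqI) (simp add: cinner_adj[OF assms, symmetric] cinner_scaleC_right)

lemma adj_eqI:
  assumes "T \<in> bounded_ops"
    and "\<And>x y. cinner (blinfun_apply T x) y = cinner x (blinfun_apply S y)"
  shows "adj T = S"
  using adj_unique[of T "adj T" S] cinner_adj[OF assms(1)] assms(2) by blast

lemma cinner_adj':
  assumes "T \<in> bounded_ops"
  shows "cinner (blinfun_apply (adj T) x) y = cinner x (blinfun_apply T y)"
  using cinner_adj[OF assms] by (metis cinner_commute)

lemma adj_adj:
  assumes "T \<in> bounded_ops"
  shows "adj (adj T) = T"
  by (rule adj_eqI[OF adj_in_bounded_ops[OF assms]]) (rule cinner_adj'[OF assms])

lemma compose_in_bounded_ops:
  assumes "S \<in> bounded_ops" and "T \<in> bounded_ops"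
  shows "S o\<^sub>L T \<in> bounded_ops"
  using assms by (simp add: bounded_ops_def)

lemma adj_compose:
  assumes "S \<in> bounded_ops" and "T \<in> bounded_ops"
  shows "adj (S o\<^sub>L T) = adj T o\<^sub>L adj S"
  by (rule adj_eqI) (simp_all add: compose_in_bounded_ops cinner_adj assms)

lemma compose_cancel:
  assumes x: "x \<in> bounded_ops" and eq: "x o\<^sub>L adj x o\<^sub>L w = x o\<^sub>L adj x o\<^sub>L w'"
  shows "adj x o\<^sub>L w = adj x o\<^sub>L w'"
proof (rule blinfun_eqI)
  fix v
  define d where "d = blinfun_apply w v - blinfun_apply w' v"
  have "blinfun_apply x (blinfun_apply (adj x) d) = 0"
    using arg_cong[OF eq, of "\<lambda>S. blinfun_apply S v"] by (simp add: d_def blinfun.diff_right)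
  then have "cinner (blinfun_apply (adj x) d) (blinfun_apply (adj x) d) = cinner 0 d"
    by (metis cinner_adj x)
  also have "\<dots> = 0"
    using cinner_diff_left[of d d d] by simp
  finally show "blinfun_apply (adj x o\<^sub>L w) v = blinfun_apply (adj x o\<^sub>L w') v"
    by (simp add: cinner_self_eq_0 d_def blinfun.diff_right)
qed

lemma star_le_adj:
  assumes x: "x \<in> bounded_ops" and y: "y \<in> bounded_ops" and le: "star_le x y"
  shows "star_le (adj x) (adj y)"
proof -
  have "adj (x o\<^sub>L adj x) = adj (y o\<^sub>L adj x)" "adj (adj x o\<^sub>L x) = adj (adj x o\<^sub>L y)"
    using le unfolding star_le_def by simp_all
  then show ?thesis
    by (simp add: star_le_def adj_compose adj_adj adj_in_bounded_ops x y)
qed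

lemma star_le_trans_left:
  assumes x: "x \<in> bounded_ops" and y: "y \<in> bounded_ops"
    and xy: "star_le x y" and yz: "star_le y z"
  shows "adj x o\<^sub>L x = adj x o\<^sub>L z"
proof -
  have 1: "x o\<^sub>L adj x = x o\<^sub>L adj y"
    using star_le_adj[OF x y xy] by (simp add: star_le_def adj_adj x)
  have "x o\<^sub>L adj x o\<^sub>L y = x o\<^sub>L (adj y o\<^sub>L y)"
    unfolding 1 by (rule blinfun_eqI) simp
  also have "\<dots> = x o\<^sub>L (adj y o\<^sub>L z)"
    using yz by (simp add: star_le_def)
  also have "\<dots> = x o\<^sub>L adj x o\<^sub>L z"
    unfolding 1 by (rule blinfun_eqI) simp
  finally show ?thesis
    using compose_cancel[OF x] xy by (simp add: star_le_def)
qed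

lemma star_le_trans:
  assumes x: "x \<in> bounded_ops" and y: "y \<in> bounded_ops" and z: "z \<in> bounded_ops"
    and xy: "star_le x y" and yz: "star_le y z"
  shows "star_le x z"
proof -
  have "adj (adj x) o\<^sub>L adj x = adj (adj x) o\<^sub>L adj z"
    by (rule star_le_trans_left[of _ "adj y"]) (simp_all add: adj_in_bounded_ops star_le_adj assms)
  then have "adj (x o\<^sub>L adj x) = adj (x o\<^sub>L adj z)"
    by (simp add: adj_adj x)
  then have "x o\<^sub>L adj x = z o\<^sub>L adj x"
    by (simp add: adj_compose adj_adj adj_in_bounded_ops x z)
  then show ?thesis
    using star_le_trans_left[OF x y xy yz] by (simp add: star_le_def)
qed

lemma star_le_antisym:
  assumes x: "x \<in> bounded_ops" and y: "y \<in> bounded_ops"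
    and xy: "star_le x y" and yx: "star_le y x"
  shows "x = y"
proof (rule blinfun_eqI)
  fix v
  have "adj (adj y o\<^sub>L y) = adj (adj y o\<^sub>L x)"
    using yx by (simp add: star_le_def)
  then have "adj y o\<^sub>L y = adj x o\<^sub>L y"
    by (simp add: adj_compose adj_adj adj_in_bounded_ops x y)
  then have eqs: "adj x o\<^sub>L x = adj x o\<^sub>L y" "adj y o\<^sub>L y = adj x o\<^sub>L y" "adj y o\<^sub>L x = adj x o\<^sub>L y"
    using xy yx by (simp_all add: star_le_def)
  let ?d = "blinfun_apply x v - blinfun_apply y v"
  have "cinner ?d ?d = cinner v (blinfun_apply (adj x o\<^sub>L x) v) - cinner v (blinfun_apply (adj x o\<^sub>L y) v)
      - (cinner v (blinfun_apply (adj y o\<^sub>L x) v) - cinner v (blinfun_apply (adj y o\<^sub>L y) v))"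
    by (simp add: cinner_diff_left cinner_diff_right cinner_adj x y)
  also have "\<dots> = 0"
    unfolding eqs by simp
  finally show "blinfun_apply x v = blinfun_apply y v"
    by (simp add: cinner_self_eq_0)
qed

lemma star_le_refl: "star_le x x"
  by (simp add: star_le_def)

lemma partial_order_star_poset:
  assumes "M \<subseteq> bounded_ops"
  shows "partial_order (star_poset M)"
proof unfold_locales
  have M: "x \<in> bounded_ops" if "x \<in> carrier (star_poset M)" for x
    using assms that by (auto simp: star_poset_def)
  fix x y z
  assume c: "x \<in> carrier (star_poset M)" "y \<in> carrier (star_poset M)"
  assume l: "x \<sqsubseteq>\<^bsub>star_poset M\<^esub> y"
  show "x .=\<^bsub>star_poset M\<^esub> y" if "y \<sqsubseteq>\<^bsub>star_poset M\<^esub> x"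
    using star_le_antisym[of x y] M c l that by (simp add: star_poset_def)
  assume "z \<in> carrier (star_poset M)" "y \<sqsubseteq>\<^bsub>star_poset M\<^esub> z"
  then show "x \<sqsubseteq>\<^bsub>star_poset M\<^esub> z"
    using star_le_trans[of x y z] M c l by (simp add: star_poset_def)
qed (simp_all add: star_poset_def star_le_refl)

end

theory Submission
  imports Defs
begin

text \<open>
  A poset with a bounded, strictly increasing rank function into the natural numbers has a discrete
  order topology. Along a monotone net the rank can grow only finitely often, so the net is
  eventually constant, and its eventual value is its supremum or infimum. If a net converges in
  order to \<open>a\<close>, then its lower and its upper bounds are therefore both eventually equal to \<open>a\<close>, and
  so is the net itself: no net leaves the set in which it lives, and every set is order closed.

  For the star order on a finite-dimensional algebra \<open>M\<close> such a rank is the codimension in \<open>M\<close> of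
  the left annihilator \<open>{T \<in> M. T x = 0}\<close>. If \<open>x\<close> lies below \<open>y\<close>, then \<open>T y = 0\<close> gives
  \<open>T x x\<^sup>* = T y x\<^sup>* = 0\<close> and hence \<open>T x = 0\<close>, so that annihilators shrink. They shrink strictly when
  \<open>x \<noteq> y\<close>: the relation \<open>x\<^sup>* x = x\<^sup>* y\<close> says that \<open>(y - x)\<^sup>*\<close> annihilates \<open>x\<close>, and if it
  annihilated \<open>y\<close> as well, then \<open>(y - x)\<^sup>* (y - x) = 0\<close>, forcing \<open>x = y\<close>.
  The annihilator takes the place of the range projection of \<open>x\<close>, whose construction would call
  for spectral theory. That dimensions are bounded and strictly monotone on subspaces of \<open>M\<close> is
  the content of \<open>dim_le_card_of_subset_span\<close> and \<open>dim_psubset_of_subset_span\<close>; the two steps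
  are joined by \<open>order_topology_discrete_of_bounded_rank\<close>.
\<close>

section \<open>Posets of bounded rank\<close>

text \<open>Beyond an index of maximal rank the net cannot move, as a move would raise the rank. The
  order enters through the rank alone, so that the lemma serves increasing and decreasing nets alike.\<close>

lemma rank_increasing_net_eventually_constant:
  fixes h :: "'a \<Rightarrow> nat"
  assumes I: "directed_set I r"
    and bound: "\<And>i. i \<in> I \<Longrightarrow> h (y i) \<le> N"
    and strict: "\<And>i j. \<lbrakk>i \<in> I; j \<in> I; r i j; y i \<noteq> y j\<rbrakk> \<Longrightarrow> h (y i) < h (y j)"
  obtains i where "i \<in> I" and "\<And>j. \<lbrakk>j \<in> I; r i j\<rbrakk> \<Longrightarrow> y j = y i"
proof -
  obtain i0 where "i0 \<in> I"
    using I unfolding directed_set_def by blast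
  \<comment> \<open>An index of maximal rank, found by minimising the distance to the bound.\<close>
  then obtain i where i: "i \<in> I" and max: "\<And>j. j \<in> I \<Longrightarrow> N - h (y i) \<le> N - h (y j)"
    using ex_has_least_nat[of "\<lambda>i. i \<in> I" i0 "\<lambda>i. N - h (y i)"] by blast
  have "y j = y i" if j: "j \<in> I" "r i j" for j
  proof (rule ccontr)
    assume "y j \<noteq> y i"
    then have "h (y i) < h (y j)"
      using strict[OF i j] by simp
    then show False
      using max[OF j(1)] bound[OF j(1)] by linarith
  qed
  then show ?thesis
    using that i by blast
qed

context partial_order
begin

text \<open>By directedness every term lies below the eventual value, which is therefore the greatest term;
  dually for decreasing nets.\<close>

lemma lub_of_eventually_constant_net:
  assumes I: "directed_set I r" and y: "y ` I \<subseteq> carrier L"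
    and mono: "\<And>i j. \<lbrakk>i \<in> I; j \<in> I; r i j\<rbrakk> \<Longrightarrow> y i \<sqsubseteq> y j" and lub: "is_lub L a (y ` I)"
    and i: "i \<in> I" and const: "\<And>j. \<lbrakk>j \<in> I; r i j\<rbrakk> \<Longrightarrow> y j = y i"
  shows "y i = a"
proof -
  have "y k \<sqsubseteq> y i" if k: "k \<in> I" for k
  proof -
    obtain l where "l \<in> I" "r i l" "r k l"
      using I i k unfolding directed_set_def by blast
    then show ?thesis
      using mono[OF k] const by metis
  qed
  then have "y i \<in> Upper L (y ` I)"
    using i y unfolding Upper_def by auto
  then have "a \<sqsubseteq> y i"
    by (rule least_le[OF lub])
  moreover have "y i \<sqsubseteq> a" and "a \<in> carrier L"
    using least_Upper_above[OF lub] least_closed[OF lub] i y by blast+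
  ultimately show ?thesis
    using i y by (intro le_antisym) auto
qed

lemma glb_of_eventually_constant_net:
  assumes I: "directed_set I r" and z: "z ` I \<subseteq> carrier L"
    and anti: "\<And>i j. \<lbrakk>i \<in> I; j \<in> I; r i j\<rbrakk> \<Longrightarrow> z j \<sqsubseteq> z i" and glb: "is_glb L a (z ` I)"
    and i: "i \<in> I" and const: "\<And>j. \<lbrakk>j \<in> I; r i j\<rbrakk> \<Longrightarrow> z j = z i"
  shows "z i = a"
proof -
  have "z i \<sqsubseteq> z k" if k: "k \<in> I" for k
  proof -
    obtain l where "l \<in> I" "r i l" "r k l"
      using I i k unfolding directed_set_def by blast
    then show ?thesis
      using anti[OF k] const by metis
  qed
  then have "z i \<in> Lower L (z ` I)"
    using i z unfolding Lower_def by auto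
  then have "z i \<sqsubseteq> a"
    by (rule greatest_le[OF glb])
  moreover have "a \<sqsubseteq> z i" and "a \<in> carrier L"
    using greatest_Lower_below[OF glb] greatest_closed[OF glb] i z by blast+
  ultimately show ?thesis
    using i z by (intro le_antisym) auto
qed

lemma order_convergent_attains_limit:
  fixes f :: "'a \<Rightarrow> nat"
  assumes bound: "\<And>u. u \<in> carrier L \<Longrightarrow> f u \<le> N"
    and strict: "\<And>u v. \<lbrakk>u \<in> carrier L; v \<in> carrier L; u \<sqsubseteq> v; u \<noteq> v\<rbrakk> \<Longrightarrow> f u < f v"
    and I: "directed_set I r" and conv: "order_convergent L I r x a"
  shows "\<exists>k\<in>I. x k = a"
proof -
  obtain y z where yz: "y ` I \<subseteq> carrier L" "z ` I \<subseteq> carrier L"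
      "\<forall>i\<in>I. y i \<sqsubseteq> x i \<and> x i \<sqsubseteq> z i"
      "\<forall>i\<in>I. \<forall>j\<in>I. r i j \<longrightarrow> y i \<sqsubseteq> y j" "is_lub L a (y ` I)"
      "\<forall>i\<in>I. \<forall>j\<in>I. r i j \<longrightarrow> z j \<sqsubseteq> z i" "is_glb L a (z ` I)"
    and a: "a \<in> carrier L" and xL: "x ` I \<subseteq> carrier L"
    using conv unfolding order_convergent_def by (elim conjE exE) (rule that)
  have yL: "y i \<in> carrier L" and zL: "z i \<in> carrier L" if "i \<in> I" for i
    using yz(1,2) that by auto
  have mono: "\<And>i j. \<lbrakk>i \<in> I; j \<in> I; r i j\<rbrakk> \<Longrightarrow> y i \<sqsubseteq> y j"
    and anti: "\<And>i j. \<lbrakk>i \<in> I; j \<in> I; r i j\<rbrakk> \<Longrightarrow> z j \<sqsubseteq> z i"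
    using yz(4,6) by blast+
  obtain i where i: "i \<in> I" "\<And>j. \<lbrakk>j \<in> I; r i j\<rbrakk> \<Longrightarrow> y j = y i"
  proof (rule rank_increasing_net_eventually_constant[OF I, of f y N])
    show "f (y i) \<le> N" if "i \<in> I" for i
      using that by (intro bound yL)
    show "f (y i) < f (y j)" if "i \<in> I" "j \<in> I" "r i j" "y i \<noteq> y j" for i j
      using that by (intro strict yL mono)
  qed (use that in blast)
  have yi: "y i = a"
    by (rule lub_of_eventually_constant_net[OF I yz(1) mono yz(5) i])
  \<comment> \<open>Along the decreasing net of upper bounds it is the corank that increases.\<close>
  obtain j where j: "j \<in> I" "\<And>k. \<lbrakk>k \<in> I; r j k\<rbrakk> \<Longrightarrow> z k = z j"
  proof (rule rank_increasing_net_eventually_constant[OF I, of "\<lambda>u. N - f u" z N])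
    show "N - f (z k) < N - f (z l)" if "k \<in> I" "l \<in> I" "r k l" "z k \<noteq> z l" for k l
      using strict[OF zL zL anti[OF that(1-3)]] bound[OF zL] that
      by (metis diff_less_mono2 order.strict_trans2)
  qed (use that in auto)
  have zj: "z j = a"
    by (rule glb_of_eventually_constant_net[OF I yz(2) anti yz(7) j])
  obtain k where k: "k \<in> I" "r i k" "r j k"
    using I i(1) j(1) unfolding directed_set_def by blast
  have "y k = a" "z k = a"
    using i(2)[OF k(1,2)] j(2)[OF k(1,3)] yi zj by simp_all
  then have "x k = a"
    using yz(3) xL k(1) a by (intro le_antisym) auto
  then show ?thesis
    using k(1) by blast
qed

text \<open>A net lying in a set attains its order limit, so the limit belongs to the set: every set is
  order closed.\<close>

lemma order_topology_discrete_of_bounded_rank: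
  fixes f :: "'a \<Rightarrow> nat"
  assumes bound: "\<And>u. u \<in> carrier L \<Longrightarrow> f u \<le> N"
    and strict: "\<And>u v. \<lbrakk>u \<in> carrier L; v \<in> carrier L; u \<sqsubseteq> v; u \<noteq> v\<rbrakk> \<Longrightarrow> f u < f v"
  shows "order_topology_of L = discrete_topology (carrier L)"
proof -
  have "order_closed L C" if C: "C \<subseteq> carrier L" for C
    unfolding order_closed_def
  proof (intro conjI C notI, elim exE conjE)
    fix I :: "('a \<times> 'a) set" and r x a
    assume I: "directed_set I r" and x: "x ` I \<subseteq> C" and a: "a \<in> carrier L - C"
      and conv: "order_convergent L I r x a"
    have "\<exists>k\<in>I. x k = a"
      by (rule order_convergent_attains_limit[OF bound strict I conv])
    then show False
      using x a by blast
  qed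
  then show ?thesis
    by (simp add: topology_eq openin_order_topology_of)
qed

end


section \<open>Left annihilators\<close>

definition left_annihilator ::
    "('h::complex_hilbert_space \<Rightarrow>\<^sub>L 'h) set \<Rightarrow> ('h \<Rightarrow>\<^sub>L 'h) \<Rightarrow> ('h \<Rightarrow>\<^sub>L 'h) set" where
  "left_annihilator M x = {T \<in> M. T o\<^sub>L x = 0}"

lemma blinfun_eq_iff: "S = T \<longleftrightarrow> (\<forall>v. blinfun_apply S v = blinfun_apply T v)"
  by (auto intro: blinfun_eqI)

lemma scaleC_zero_right: "c *\<^sub>C 0 = 0"
  using norm_scaleC[of c 0] by simp

lemma subspace_left_annihilator:
  assumes "cop.subspace M"
  shows "cop.subspace (left_annihilator M x)"
  using assms unfolding cop.subspace_def left_annihilator_def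
  by (simp add: blinfun_eq_iff blinfun.add_left scaleC_op.rep_eq scaleC_zero_right)

lemma adj_compose_self_eq_0D:
  assumes S: "S \<in> bounded_ops" and "adj S o\<^sub>L S = 0"
  shows "S = 0"
proof (rule blinfun_eqI)
  fix v
  have "cinner (blinfun_apply S v) (blinfun_apply S v) = cinner v (blinfun_apply (adj S o\<^sub>L S) v)"
    by (simp add: cinner_adj S)
  also have "\<dots> = 0"
    using assms(2) cinner_diff_right[of v v v] by simp
  finally show "blinfun_apply S v = blinfun_apply 0 v"
    by (simp add: cinner_self_eq_0)
qed

lemma compose_adj_self_eq_0D:
  assumes S: "S \<in> bounded_ops" and "S o\<^sub>L adj S = 0"
  shows "S = 0"
proof -
  have "adj S = 0"
    by (rule adj_compose_self_eq_0D) (simp_all add: assms adj_in_bounded_ops adj_adj)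
  then have "adj S o\<^sub>L S = 0"
    by (simp add: blinfun_eq_iff)
  then show ?thesis
    by (rule adj_compose_self_eq_0D[OF S])
qed

text \<open>The square \<open>(T x) (T x)\<^sup>*\<close> contains the factor \<open>x x\<^sup>*\<close>, which the star order turns
  into \<open>y x\<^sup>*\<close>.\<close>

lemma left_annihilator_antimono:
  assumes M: "M \<subseteq> bounded_ops" and x: "x \<in> bounded_ops" and le: "star_le x y"
  shows "left_annihilator M y \<subseteq> left_annihilator M x"
proof
  fix T assume "T \<in> left_annihilator M y"
  then have T: "T \<in> M" "T \<in> bounded_ops" "T o\<^sub>L y = 0"
    using M by (auto simp: left_annihilator_def)
  have "(T o\<^sub>L x) o\<^sub>L adj (T o\<^sub>L x) = T o\<^sub>L (x o\<^sub>L adj x) o\<^sub>L adj T"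
    by (simp add: adj_compose T x blinfun_eq_iff)
  also have "\<dots> = (T o\<^sub>L y) o\<^sub>L (adj x o\<^sub>L adj T)"
    using le by (simp add: star_le_def blinfun_eq_iff)
  also have "\<dots> = 0"
    using T by (simp add: blinfun_eq_iff)
  finally have "T o\<^sub>L x = 0"
    by (rule compose_adj_self_eq_0D[OF compose_in_bounded_ops[OF T(2) x]])
  then show "T \<in> left_annihilator M x"
    using T by (simp add: left_annihilator_def)
qed

text \<open>The operator \<open>(y - x)\<^sup>*\<close> witnesses the strictness: it annihilates \<open>x\<close> because the star
  order makes \<open>y - x\<close> orthogonal to \<open>x\<close>, and it annihilates \<open>y = x + (y - x)\<close> only if
  \<open>y - x = 0\<close>.\<close>

lemma left_annihilator_psubset:
  assumes M: "cstar_subalgebra M" and x: "x \<in> M" and y: "y \<in> M"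
    and le: "star_le x y" and ne: "x \<noteq> y"
  shows "left_annihilator M y \<subset> left_annihilator M x"
proof -
  define d where "d = y - x"
  have sub: "M \<subseteq> bounded_ops"
    using M by (simp add: cstar_subalgebra_def)
  have dM: "d \<in> M" and adM: "adj d \<in> M"
    using M x y cop.subspace_diff unfolding d_def cstar_subalgebra_def by blast+
  have ops: "x \<in> bounded_ops" "d \<in> bounded_ops"
    using sub x dM by blast+
  have "adj x o\<^sub>L d = 0"
    using le by (simp add: star_le_def d_def blinfun_eq_iff blinfun.diff_left blinfun.diff_right)
  then have "adj (adj d o\<^sub>L x) = 0"
    by (simp add: adj_compose adj_adj adj_in_bounded_ops ops)
  then have "(adj d o\<^sub>L x) o\<^sub>L adj (adj d o\<^sub>L x) = 0"
    by (simp add: blinfun_eq_iff)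
  then have adx: "adj d o\<^sub>L x = 0"
    by (rule compose_adj_self_eq_0D[OF compose_in_bounded_ops[OF adj_in_bounded_ops[OF ops(2)] ops(1)]])
  have "adj d o\<^sub>L y \<noteq> 0"
  proof
    assume "adj d o\<^sub>L y = 0"
    with adx have "adj d o\<^sub>L d = 0"
      by (simp add: d_def blinfun_eq_iff blinfun.diff_left blinfun.diff_right)
    then have "d = 0"
      by (rule adj_compose_self_eq_0D[OF ops(2)])
    with ne show False
      by (simp add: d_def)
  qed
  then have "adj d \<in> left_annihilator M x - left_annihilator M y"
    using adx adM by (simp add: left_annihilator_def)
  then show ?thesis
    using left_annihilator_antimono[OF sub ops(1) le] by blast
qed


section \<open>Dimension of subspaces inside a finite span\<close>

text \<open>The ambient space of operators may be infinite-dimensional, and \<open>dim\<close> takes the value \<open>0\<close> on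
  its infinite-dimensional subspaces. The hypothesis \<open>S \<subseteq> span B\<close> with \<open>B\<close> finite makes the bases finite, so that
  the exchange lemma compares their cardinalities.\<close>

context vector_space
begin

lemma finite_basis_of_subset_span:
  assumes B: "finite B" and S: "S \<subseteq> span B"
  obtains A where "A \<subseteq> S" "independent A" "S \<subseteq> span A" "finite A" "card A = dim S"
    "card A \<le> card B"
proof -
  obtain A where A: "A \<subseteq> S" "independent A" "S \<subseteq> span A" "card A = dim S"
    using basis_exists by blast
  have "finite A \<and> card A \<le> card B"
    using A S by (intro independent_span_bound[OF B]) auto
  then show ?thesis
    using that A by blast
qed

lemma dim_le_card_of_subset_span:
  assumes "finite B" and "S \<subseteq> span B"
  shows "dim S \<le> card B"
  by (metis finite_basis_of_subset_span[OF assms])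

lemma dim_psubset_of_subset_span:
  assumes B: "finite B" and T: "T \<subseteq> span B" and S: "subspace S" and ST: "S \<subset> T"
  shows "dim S < dim T"
proof -
  have "S \<subseteq> span B"
    using ST T by blast
  then obtain A where A: "A \<subseteq> S" "independent A" "finite A" "card A = dim S"
    using finite_basis_of_subset_span[OF B] by metis
  obtain C where C: "T \<subseteq> span C" "finite C" "card C = dim T"
    using finite_basis_of_subset_span[OF B T] by metis
  obtain t where t: "t \<in> T" "t \<notin> S"
    using ST by blast
  have "span A \<subseteq> S"
    by (rule span_minimal[OF A(1) S])
  then have "independent (insert t A)" and tA: "t \<notin> A"
    using t A by (auto simp: independent_insert)
  then have "card (insert t A) \<le> card C"
    using independent_span_bound[OF C(2), of "insert t A"] A(1) C(1) ST t by blast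
  then show ?thesis
    using A C tA by simp
qed

end


section \<open>Discreteness\<close>

theorem theorem4p10:
  fixes M :: "('h::complex_hilbert_space \<Rightarrow>\<^sub>L 'h) set"
  assumes "von_neumann_algebra M"
    and "complex_finite_dimensional M"
  shows "order_topology_of (star_poset M) = discrete_topology M"
proof -
  have M: "cstar_subalgebra M"
    using assms(1) by (simp add: von_neumann_algebra_def)
  then have sub: "M \<subseteq> bounded_ops" and subsp: "cop.subspace M"
    by (simp_all add: cstar_subalgebra_def)
  obtain B where B: "finite B" "M = cop.span B"
    using assms(2) by (auto simp: complex_finite_dimensional_def)
  have ann: "left_annihilator M x \<subseteq> cop.span B" for x
    using B(2) by (auto simp: left_annihilator_def)
  interpret partial_order "star_poset M"
    by (rule partial_order_star_poset[OF sub])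
  have "order_topology_of (star_poset M) = discrete_topology (carrier (star_poset M))"
  proof (rule order_topology_discrete_of_bounded_rank)
    fix x y
    assume xy: "x \<in> carrier (star_poset M)" "y \<in> carrier (star_poset M)"
      "x \<sqsubseteq>\<^bsub>star_poset M\<^esub> y" "x \<noteq> y"
    then have "cop.dim (left_annihilator M y) < cop.dim (left_annihilator M x)"
      using left_annihilator_psubset[OF M, of x y]
      by (intro cop.dim_psubset_of_subset_span[OF B(1) ann] subspace_left_annihilator subsp)
        (simp add: star_poset_def)
    then show "card B - cop.dim (left_annihilator M x) < card B - cop.dim (left_annihilator M y)"
      using cop.dim_le_card_of_subset_span[OF B(1) ann[of x]] by linarith
  qed (rule diff_le_self)
  then show ?thesis
    by (simp add: star_poset_def)
qed

end
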